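(* If $K_1$ and $K_2$ are non-trivial demonstrative subgroups of R. Thompson's group $V$, then the (abstract) free product $K_1*K_2$ belongs to the class $\mathcal{FPV}$; in particular $K_1*K_2$ embeds into $V$.
   Context: R. Thompson's group $V$: let $\mathcal{T}_2$ be the infinite rooted binary tree with nodes labelled by finite binary strings, and let $\mathfrak{C}=\{0,1\}^{\mathbb{N}}$ be the Cantor set, identified with the infinite descending paths from the root. For a node $n$, $\mathfrak{C}_n\subset\mathfrak{C}$ is the set of infinite strings with prefix $n$. $V$ is the group (under composition) of all homeomorphisms of $\mathfrak{C}$ that can be represented by a tree pair $P=(D,R)$ together with a bijection $\sigma$, where $D$, $R$ are finite rooted binary subtrees of $\mathcal{T}_2$ (containing the root of $\mathcal{T}_2$, each node having $0$ or $2$ children in the subtree) with the same number of leaves and $\sigma$ is a bijection from the leaves of $D$ to the leaves of $R$; the homeomorphism maps $\mathfrak{C}_i$ onto $\mathfrak{C}_{\sigma(i)}$ for each leaf $i$ of $D$ by the prefix replacement $iw\mapsto \sigma(i)w$. It thereby acts on nodes at or below leaves of $D$ (a leaf $i$ goes to the node $\sigma(i)$). Elements of $V$ act on the right. Revealing pairs: for a tree pair $P=(D,R)$ (with bijection $\sigma$), let $C=D\cap R$. Each leaf of $C$ is either a leaf of both $D$ and $R$ (a \emph{neutral leaf} of $P$), or the root of a non-trivial descending subtree of $D$ (a component of $D\setminus R$), or the root of a non-trivial descending subtree of $R$ (a component of $R\setminus D$). $P$ is a \emph{revealing pair} if (i) each component $X$ of $D\setminus R$ has a leaf $r_X$ which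 under iteration of $\sigma$ travels through neutral leaves until it is finally mapped to the root of $X$; and (ii) for each component $Y$ of $R\setminus D$, the root $n_Y$ of $Y$ under iteration of $\sigma$ travels through neutral leaves until it is finally mapped to a leaf $l_Y$ of $Y$. Demonstrative groups: a subgroup $G\le V$ is \emph{demonstrative} if there is a node $n\in\mathcal{T}_2$ such that every non-trivial $g\in G$ admits a revealing pair $P_g=(D_g,R_g)$ representing it for which $n$ is a neutral leaf and $n$ is moved to a different node of $\mathcal{T}_2$ by $g$. Such a node is a \emph{demonstration node} for $G$. $\mathcal{FPV}$ is the class of groups which (1) admit a decomposition as a free product of a pair of non-trivial subgroups, and (2) embed into $V$. *)

theory Defs
  imports
    "HOL-Analysis.Function_Topology"
    "HOL-Algebra.Group"
    "HOL-Library.Sublist"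
    "HOL-Library.Omega_Words_Fun"
begin

section \<open>The binary tree and R. Thompson's group V\<close>

text \<open>
  The Cantor set is the type \<^typ>\<open>nat \<Rightarrow> bool\<close> with the product topology; \<open>n \<frown> w\<close> is the infinite
  string obtained by prepending the finite string \<open>n\<close> to \<open>w\<close>. A subtree is given by its set of nodes.
\<close>

type_synonym node = "bool list"
type_synonym cantor = "nat \<Rightarrow> bool"

definition finite_subtree :: "node set \<Rightarrow> bool" where
  "finite_subtree T \<longleftrightarrow>
     finite T \<and> [] \<in> T \<and> (\<forall>x b. x @ [b] \<in> T \<longrightarrow> x \<in> T \<and> x @ [\<not> b] \<in> T)"

definition leaves :: "node set \<Rightarrow> node set" where
  "leaves T = {x \<in> T. \<forall>b. x @ [b] \<notin> T}"

text \<open>Only the values of \<open>\<sigma>\<close> on the leaves of \<open>D\<close> are relevant.\<close>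

definition tree_pair :: "node set \<Rightarrow> node set \<Rightarrow> (node \<Rightarrow> node) \<Rightarrow> bool" where
  "tree_pair D R \<sigma> \<longleftrightarrow>
     finite_subtree D \<and> finite_subtree R \<and> bij_betw \<sigma> (leaves D) (leaves R)"

definition represents ::
  "node set \<Rightarrow> node set \<Rightarrow> (node \<Rightarrow> node) \<Rightarrow> (cantor \<Rightarrow> cantor) \<Rightarrow> bool" where
  "represents D R \<sigma> f \<longleftrightarrow>
     tree_pair D R \<sigma> \<and> (\<forall>i\<in>leaves D. \<forall>w. f (i \<frown> w) = \<sigma> i \<frown> w)"

text \<open>Elements of V act on the right, so the product of \<open>f\<close> and \<open>g\<close> is ``first \<open>f\<close>, then \<open>g\<close>''.\<close>

definition thompson_V :: "(cantor \<Rightarrow> cantor) monoid" where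
  "thompson_V =
     \<lparr>carrier = {f. (\<exists>g. homeomorphism UNIV UNIV f g) \<and> (\<exists>D R \<sigma>. represents D R \<sigma> f)},
      mult = (\<lambda>f g. g \<circ> f),
      one = id\<rparr>"


section \<open>Revealing pairs and demonstrative subgroups\<close>

definition neutral_leaves :: "node set \<Rightarrow> node set \<Rightarrow> node set" where
  "neutral_leaves D R = leaves D \<inter> leaves R"

text \<open>
  A component of \<open>S - T\<close> is represented by its root, which is a leaf of \<open>S \<inter> T\<close> that is not a leaf of
  \<open>S\<close>. Its leaves are the leaves of \<open>S\<close> below that root.
\<close>

definition component_roots :: "node set \<Rightarrow> node set \<Rightarrow> node set" where
  "component_roots S T = leaves (S \<inter> T) - leaves S"

definition component_leaves :: "node set \<Rightarrow> node \<Rightarrow> node set" where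
  "component_leaves S x = {l \<in> leaves S. strict_prefix x l}"

text \<open>
  \<open>travels D R \<sigma> x y\<close>: some positive iterate of \<open>\<sigma>\<close> takes \<open>x\<close> to \<open>y\<close>, and all nodes strictly in
  between (possibly none) are neutral leaves.
\<close>

definition travels ::
  "node set \<Rightarrow> node set \<Rightarrow> (node \<Rightarrow> node) \<Rightarrow> node \<Rightarrow> node \<Rightarrow> bool" where
  "travels D R \<sigma> x y \<longleftrightarrow>
     (\<exists>k>0. (\<forall>j. 0 < j \<and> j < k \<longrightarrow> (\<sigma> ^^ j) x \<in> neutral_leaves D R) \<and> (\<sigma> ^^ k) x = y)"

definition revealing_pair :: "node set \<Rightarrow> node set \<Rightarrow> (node \<Rightarrow> node) \<Rightarrow> bool" where
  "revealing_pair D R \<sigma> \<longleftrightarrow>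
     tree_pair D R \<sigma> \<and>
     (\<forall>x\<in>component_roots D R. \<exists>r\<in>component_leaves D x. travels D R \<sigma> r x) \<and>
     (\<forall>y\<in>component_roots R D. \<exists>l\<in>component_leaves R y. travels D R \<sigma> y l)"

definition demonstration_node :: "node \<Rightarrow> (cantor \<Rightarrow> cantor) set \<Rightarrow> bool" where
  "demonstration_node n K \<longleftrightarrow>
     (\<forall>g\<in>K. g \<noteq> \<one>\<^bsub>thompson_V\<^esub> \<longrightarrow>
        (\<exists>D R \<sigma>. represents D R \<sigma> g \<and> revealing_pair D R \<sigma> \<and>
                 n \<in> neutral_leaves D R \<and> \<sigma> n \<noteq> n))"

definition demonstrative :: "(cantor \<Rightarrow> cantor) set \<Rightarrow> bool" where
  "demonstrative K \<longleftrightarrow> subgroup K thompson_V \<and> (\<exists>n. demonstration_node n K)"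


section \<open>Free products\<close>

text \<open>
  The free product of \<open>G\<close> and \<open>H\<close> consists of the words in the disjoint union of the two carriers,
  modulo the congruence that deletes identity letters and multiplies adjacent letters
  from the same factor.
\<close>

definition words :: "('a, 'c) monoid_scheme \<Rightarrow> ('b, 'd) monoid_scheme \<Rightarrow> ('a + 'b) list set" where
  "words G H = lists (carrier G <+> carrier H)"

inductive_set word_cong ::
    "('a, 'c) monoid_scheme \<Rightarrow> ('b, 'd) monoid_scheme \<Rightarrow> (('a + 'b) list \<times> ('a + 'b) list) set"
  for G :: "('a, 'c) monoid_scheme" and H :: "('b, 'd) monoid_scheme"
where
  refl: "w \<in> words G H \<Longrightarrow> (w, w) \<in> word_cong G H"
| sym: "(v, w) \<in> word_cong G H \<Longrightarrow> (w, v) \<in> word_cong G H"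
| trans: "(u, v) \<in> word_cong G H \<Longrightarrow> (v, w) \<in> word_cong G H \<Longrightarrow> (u, w) \<in> word_cong G H"
| one1: "u \<in> words G H \<Longrightarrow> v \<in> words G H \<Longrightarrow>
    (u @ [Inl \<one>\<^bsub>G\<^esub>] @ v, u @ v) \<in> word_cong G H"
| one2: "u \<in> words G H \<Longrightarrow> v \<in> words G H \<Longrightarrow>
    (u @ [Inr \<one>\<^bsub>H\<^esub>] @ v, u @ v) \<in> word_cong G H"
| mult1: "u \<in> words G H \<Longrightarrow> v \<in> words G H \<Longrightarrow> x \<in> carrier G \<Longrightarrow> y \<in> carrier G \<Longrightarrow>
    (u @ [Inl x, Inl y] @ v, u @ [Inl (x \<otimes>\<^bsub>G\<^esub> y)] @ v) \<in> word_cong G H"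
| mult2: "u \<in> words G H \<Longrightarrow> v \<in> words G H \<Longrightarrow> x \<in> carrier H \<Longrightarrow> y \<in> carrier H \<Longrightarrow>
    (u @ [Inr x, Inr y] @ v, u @ [Inr (x \<otimes>\<^bsub>H\<^esub> y)] @ v) \<in> word_cong G H"

definition word_class ::
  "('a, 'c) monoid_scheme \<Rightarrow> ('b, 'd) monoid_scheme \<Rightarrow> ('a + 'b) list \<Rightarrow> ('a + 'b) list set" where
  "word_class G H w = word_cong G H `` {w}"

definition free_product ::
  "('a, 'c) monoid_scheme \<Rightarrow> ('b, 'd) monoid_scheme \<Rightarrow> ('a + 'b) list set monoid" where
  "free_product G H =
     \<lparr>carrier = words G H // word_cong G H,
      mult = (\<lambda>U W. \<Union>u\<in>U. \<Union>w\<in>W. word_class G H (u @ w)),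
      one = word_class G H []\<rparr>"

text \<open>
  \<open>G\<close> is the free product of its subgroups \<open>A\<close> and \<open>B\<close> if the canonical homomorphism from the abstract
  free product, extending the two inclusions, is an isomorphism onto \<open>G\<close>.
\<close>

definition is_free_product_of ::
  "('a, 'c) monoid_scheme \<Rightarrow> 'a set \<Rightarrow> 'a set \<Rightarrow> bool" where
  "is_free_product_of G A B \<longleftrightarrow>
     subgroup A G \<and> subgroup B G \<and>
     (\<exists>h \<in> iso (free_product (G\<lparr>carrier := A\<rparr>) (G\<lparr>carrier := B\<rparr>)) G.
        (\<forall>a\<in>A. h (word_class (G\<lparr>carrier := A\<rparr>) (G\<lparr>carrier := B\<rparr>) [Inl a]) = a) \<and>
        (\<forall>b\<in>B. h (word_class (G\<lparr>carrier := A\<rparr>) (G\<lparr>carrier := B\<rparr>) [Inr b]) = b))"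


section \<open>The class FPV\<close>

definition embeds_into_V :: "('a, 'c) monoid_scheme \<Rightarrow> bool" where
  "embeds_into_V G \<longleftrightarrow> mon G thompson_V \<noteq> {}"

definition FPV :: "('a, 'c) monoid_scheme \<Rightarrow> bool" where
  "FPV G \<longleftrightarrow>
     group G \<and>
     (\<exists>A B. is_free_product_of G A B \<and> A \<noteq> {\<one>\<^bsub>G\<^esub>} \<and> B \<noteq> {\<one>\<^bsub>G\<^esub>}) \<and>
     embeds_into_V G"

end

theory Submission
  imports Defs "HOL-Algebra.Coset"
begin

text \<open>
  The proof is a ping-pong argument inside V. Let \<open>n\<close> be a demonstration node of a subgroup \<open>K\<close>.
  For every non-trivial \<open>g\<close> in \<open>K\<close>, both \<open>n\<close> and its image node are leaves of the range tree of the
  same tree pair, and they differ, so they are incomparable: \<open>g\<close> maps the cone below \<open>n\<close> off itself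
  (\<open>demonstration_node_moves_cone\<close>). When \<open>K\<close> is non-trivial, \<open>n\<close> cannot be the root, and
  then some element of V inflates the cone below \<open>n\<close> until the complement fits into a given cone of
  depth two (\<open>expand_cone\<close>). Conjugating by that element gives a copy of \<open>K\<close> in V and a set \<open>U\<close>, with
  small complement, that all non-trivial elements of the copy map off itself.

  Doing this for both groups, with complements inside two disjoint cones, gives sets \<open>U\<close> and \<open>W\<close>
  that together cover the Cantor set and share a point \<open>p\<close>. Follow \<open>p\<close> under a non-empty reduced
  word in the two copies. The first letter moves \<open>p\<close> out of the set belonging to its factor, hence
  into the other set, where the second letter applies, and so on; the point never returns to
  \<open>U \<inter> W\<close>, so the word is not trivial (\<open>ping_pong\<close>). The common point \<open>p\<close> makes this
  work for two factors of order two as well, where ping-pong with disjoint sets fails.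

  Since every word is congruent to a reduced one, the map from the abstract free product to V given
  by the universal property is injective (\<open>lift_mon\<close>). That the abstract free product is also the
  internal free product of the images of its factors is formal
  (\<open>is_free_product_of_free_product\<close>).

  To see that the conjugated maps lie in V, it is convenient to replace tree pairs by a single
  number: V consists of the bijections that, for some \<open>N\<close>, replace every prefix of length \<open>N\<close> by a
  finite string (\<open>carrier_V\<close>). This form is visibly closed under composition and inversion.
\<close>

section \<open>The group structure of the free product\<close>

lemma words_Nil [simp]: "[] \<in> words G H"
  by (simp add: words_def)

lemma words_append [simp]: "u @ w \<in> words G H \<longleftrightarrow> u \<in> words G H \<and> w \<in> words G H"
  by (auto simp: words_def)

lemma words_Inl [simp]: "Inl x # w \<in> words G H \<longleftrightarrow> x \<in> carrier G \<and> w \<in> words G H"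
  by (auto simp: words_def)

lemma words_Inr [simp]: "Inr x # w \<in> words G H \<longleftrightarrow> x \<in> carrier H \<and> w \<in> words G H"
  by (auto simp: words_def)

locale group_pair = G: group G + H: group H
  for G :: "('a, 'c) monoid_scheme" and H :: "('b, 'd) monoid_scheme"
begin

lemma cong_words: "(v, w) \<in> word_cong G H \<Longrightarrow> v \<in> words G H \<and> w \<in> words G H"
  by (induction rule: word_cong.induct) auto

lemma equiv_cong: "equiv (words G H) (word_cong G H)"
  by (rule equivI)
     (auto simp: refl_on_def sym_def trans_def dest: cong_words
        intro: word_cong.refl word_cong.sym word_cong.trans)

lemma cong_append_left:
  assumes "(v, w) \<in> word_cong G H" and t: "t \<in> words G H"
  shows "(t @ v, t @ w) \<in> word_cong G H"
  using assms(1)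
proof (induction rule: word_cong.induct)
  case (refl w) then show ?case using t by (simp add: word_cong.refl)
next
  case (sym v w) then show ?case by (blast intro: word_cong.sym)
next
  case (trans u v w) then show ?case by (blast intro: word_cong.trans)
next
  case (one1 u v) then show ?case using word_cong.one1[of "t @ u" G H v] t by simp
next
  case (one2 u v) then show ?case using word_cong.one2[of "t @ u" G H v] t by simp
next
  case (mult1 u v x y) then show ?case using word_cong.mult1[of "t @ u" G H v x y] t by simp
next
  case (mult2 u v x y) then show ?case using word_cong.mult2[of "t @ u" G H v x y] t by simp
qed

lemma cong_append_right:
  assumes "(v, w) \<in> word_cong G H" and t: "t \<in> words G H"
  shows "(v @ t, w @ t) \<in> word_cong G H"
  using assms(1)
proof (induction rule: word_cong.induct)
  case (refl w) then show ?case using t by (simp add: word_cong.refl)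
next
  case (sym v w) then show ?case by (blast intro: word_cong.sym)
next
  case (trans u v w) then show ?case by (blast intro: word_cong.trans)
next
  case (one1 u v) then show ?case using word_cong.one1[of u G H "v @ t"] t by simp
next
  case (one2 u v) then show ?case using word_cong.one2[of u G H "v @ t"] t by simp
next
  case (mult1 u v x y) then show ?case using word_cong.mult1[of u G H "v @ t" x y] t by simp
next
  case (mult2 u v x y) then show ?case using word_cong.mult2[of u G H "v @ t" x y] t by simp
qed

lemma cong_append:
  assumes "(u, v) \<in> word_cong G H" and "(s, t) \<in> word_cong G H"
  shows "(u @ s, v @ t) \<in> word_cong G H"
  using assms cong_append_left cong_append_right cong_words word_cong.trans by meson

lemma class_eq_iff:
  "u \<in> words G H \<Longrightarrow> v \<in> words G H \<Longrightarrow>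
    word_class G H u = word_class G H v \<longleftrightarrow> (u, v) \<in> word_cong G H"
  unfolding word_class_def using equiv_cong by (rule eq_equiv_class_iff)

lemma carrier_free_product: "carrier (free_product G H) = word_class G H ` words G H"
  by (auto simp: free_product_def quotient_def word_class_def)

lemma one_free_product: "\<one>\<^bsub>free_product G H\<^esub> = word_class G H []"
  by (simp add: free_product_def)

lemma mult_class:
  assumes "u \<in> words G H" and "w \<in> words G H"
  shows "word_class G H u \<otimes>\<^bsub>free_product G H\<^esub> word_class G H w = word_class G H (u @ w)"
proof -
  have "word_class G H (u' @ w') = word_class G H (u @ w)"
    if "u' \<in> word_class G H u" "w' \<in> word_class G H w" for u' w'
  proof -
    have "(u, u') \<in> word_cong G H" "(w, w') \<in> word_cong G H"
      using that by (simp_all add: word_class_def)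
    then have c: "(u @ w, u' @ w') \<in> word_cong G H" by (rule cong_append)
    show ?thesis
      using c cong_words[OF c] by (simp only: class_eq_iff[symmetric])
  qed
  then have "(\<Union>u'\<in>word_class G H u. \<Union>w'\<in>word_class G H w. word_class G H (u' @ w')) =
      (\<Union>u'\<in>word_class G H u. \<Union>w'\<in>word_class G H w. word_class G H (u @ w))"
    by (intro SUP_cong HOL.refl)
  also have "\<dots> = word_class G H (u @ w)"
  proof -
    have "u \<in> word_class G H u" "w \<in> word_class G H w"
      using assms by (simp_all add: word_class_def word_cong.refl)
    then have "word_class G H u \<noteq> {}" "word_class G H w \<noteq> {}" by auto
    then show ?thesis by simp
  qed
  finally show ?thesis by (simp add: free_product_def)
qed

fun letter_inv :: "'a + 'b \<Rightarrow> 'a + 'b" where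
  "letter_inv (Inl x) = Inl (inv\<^bsub>G\<^esub> x)"
| "letter_inv (Inr y) = Inr (inv\<^bsub>H\<^esub> y)"

lemma letter_inv_cong:
  assumes "[x] \<in> words G H"
  shows "([letter_inv x, x], []) \<in> word_cong G H"
proof (cases x)
  case (Inl a)
  then show ?thesis
    using assms word_cong.mult1[of "[]" G H "[]" "inv\<^bsub>G\<^esub> a" a] word_cong.one1[of "[]" G H "[]"]
    by (auto intro: word_cong.trans)
next
  case (Inr a)
  then show ?thesis
    using assms word_cong.mult2[of "[]" G H "[]" "inv\<^bsub>H\<^esub> a" a] word_cong.one2[of "[]" G H "[]"]
    by (auto intro: word_cong.trans)
qed

lemma word_left_inverse:
  assumes "w \<in> words G H"
  shows "\<exists>v\<in>words G H. (v @ w, []) \<in> word_cong G H"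
  using assms
proof (induction w)
  case Nil
  show ?case by (rule bexI[of _ "[]"]) (simp_all add: word_cong.refl)
next
  case (Cons x w)
  have x: "[x] \<in> words G H" and w: "w \<in> words G H"
    using Cons.prems by (auto simp: words_def)
  then obtain v where v: "v \<in> words G H" "(v @ w, []) \<in> word_cong G H"
    using Cons.IH by blast
  have lx: "[letter_inv x] \<in> words G H"
    using cong_words[OF letter_inv_cong[OF x]] by (auto simp: words_def)
  have "(v @ [letter_inv x, x] @ w, v @ [] @ w) \<in> word_cong G H"
    using cong_append_left[OF cong_append_right[OF letter_inv_cong[OF x] w] v(1)] .
  with v have "((v @ [letter_inv x]) @ (x # w), []) \<in> word_cong G H"
    by (auto intro: word_cong.trans)
  then show ?case using v lx by (intro bexI[of _ "v @ [letter_inv x]"]) auto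
qed

lemma group_free_product: "group (free_product G H)"
proof (rule groupI)
  fix x assume "x \<in> carrier (free_product G H)"
  then obtain w where w: "w \<in> words G H" "x = word_class G H w"
    by (auto simp: carrier_free_product)
  then obtain v where "v \<in> words G H" "(v @ w, []) \<in> word_cong G H"
    using word_left_inverse by blast
  then show "\<exists>y\<in>carrier (free_product G H). y \<otimes>\<^bsub>free_product G H\<^esub> x = \<one>\<^bsub>free_product G H\<^esub>"
    using w by (auto simp: carrier_free_product mult_class one_free_product class_eq_iff)
qed (auto simp: carrier_free_product mult_class one_free_product)

lemma inl_hom: "(\<lambda>a. word_class G H [Inl a]) \<in> hom G (free_product G H)"
proof (rule homI)
  fix x y assume "x \<in> carrier G" "y \<in> carrier G"
  then show "word_class G H [Inl (x \<otimes>\<^bsub>G\<^esub> y)] =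
      word_class G H [Inl x] \<otimes>\<^bsub>free_product G H\<^esub> word_class G H [Inl y]"
    using word_cong.mult1[of "[]" G H "[]" x y]
    by (auto simp: mult_class class_eq_iff intro: word_cong.sym)
qed (auto simp: carrier_free_product)

lemma inr_hom: "(\<lambda>b. word_class G H [Inr b]) \<in> hom H (free_product G H)"
proof (rule homI)
  fix x y assume "x \<in> carrier H" "y \<in> carrier H"
  then show "word_class G H [Inr (x \<otimes>\<^bsub>H\<^esub> y)] =
      word_class G H [Inr x] \<otimes>\<^bsub>free_product G H\<^esub> word_class G H [Inr y]"
    using word_cong.mult2[of "[]" G H "[]" x y]
    by (auto simp: mult_class class_eq_iff intro: word_cong.sym)
qed (auto simp: carrier_free_product)

end


section \<open>The universal property\<close>

fun word_prod :: "('e, 'f) monoid_scheme \<Rightarrow> ('a \<Rightarrow> 'e) \<Rightarrow> ('b \<Rightarrow> 'e) \<Rightarrow> ('a + 'b) list \<Rightarrow> 'e" where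
  "word_prod M f g [] = \<one>\<^bsub>M\<^esub>"
| "word_prod M f g (x # w) = case_sum f g x \<otimes>\<^bsub>M\<^esub> word_prod M f g w"

locale hom_pair = group_pair G H + M: group M
  for G :: "('a, 'c) monoid_scheme" and H :: "('b, 'd) monoid_scheme"
    and M :: "('e, 'f) monoid_scheme" +
  fixes f g
  assumes f_hom: "f \<in> hom G M" and g_hom: "g \<in> hom H M"
begin

lemma f_one [simp]: "f \<one>\<^bsub>G\<^esub> = \<one>\<^bsub>M\<^esub>" and g_one [simp]: "g \<one>\<^bsub>H\<^esub> = \<one>\<^bsub>M\<^esub>"
  using f_hom g_hom G.is_group H.is_group M.is_group by (simp_all add: hom_one)

lemma f_closed [simp]: "x \<in> carrier G \<Longrightarrow> f x \<in> carrier M"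
  and g_closed [simp]: "y \<in> carrier H \<Longrightarrow> g y \<in> carrier M"
  using f_hom g_hom by (auto simp: hom_in_carrier)

lemma f_mult: "x \<in> carrier G \<Longrightarrow> y \<in> carrier G \<Longrightarrow> f (x \<otimes>\<^bsub>G\<^esub> y) = f x \<otimes>\<^bsub>M\<^esub> f y"
  and g_mult: "x' \<in> carrier H \<Longrightarrow> y' \<in> carrier H \<Longrightarrow> g (x' \<otimes>\<^bsub>H\<^esub> y') = g x' \<otimes>\<^bsub>M\<^esub> g y'"
  using f_hom g_hom by (auto simp: hom_mult)

lemma word_prod_closed [simp]: "w \<in> words G H \<Longrightarrow> word_prod M f g w \<in> carrier M"
  by (induction w) (auto simp: words_def)

lemma word_prod_append:
  "u \<in> words G H \<Longrightarrow> w \<in> words G H \<Longrightarrow>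
    word_prod M f g (u @ w) = word_prod M f g u \<otimes>\<^bsub>M\<^esub> word_prod M f g w"
proof (induction u)
  case (Cons x u)
  have "case_sum f g x \<in> carrier M" and "u \<in> words G H"
    using Cons.prems by (auto simp: words_def)
  with Cons show ?case by (simp add: M.m_assoc)
qed simp

lemma word_prod_cong: "(v, w) \<in> word_cong G H \<Longrightarrow> word_prod M f g v = word_prod M f g w"
  by (induction rule: word_cong.induct)
     (simp_all add: word_prod_append f_mult g_mult M.m_assoc)

text \<open>
  The congruence preserves the product of a word in \<open>M\<close>, so any representative of a class gives the
  same value.
\<close>
definition lift :: "('a + 'b) list set \<Rightarrow> 'e" where
  "lift U = word_prod M f g (SOME u. u \<in> U)"

lemma lift_class:
  assumes "w \<in> words G H"
  shows "lift (word_class G H w) = word_prod M f g w"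
proof -
  have "w \<in> word_class G H w"
    using assms by (simp add: word_class_def word_cong.refl)
  then have "(SOME u. u \<in> word_class G H w) \<in> word_class G H w"
    by (rule someI)
  then show ?thesis
    unfolding lift_def using word_prod_cong by (simp add: word_class_def)
qed

lemma lift_hom: "lift \<in> hom (free_product G H) M"
  by (rule homI) (auto simp: carrier_free_product lift_class mult_class word_prod_append)

lemma inj_on_lift:
  assumes "\<And>w. w \<in> words G H \<Longrightarrow> word_prod M f g w = \<one>\<^bsub>M\<^esub> \<Longrightarrow> (w, []) \<in> word_cong G H"
  shows "inj_on lift (carrier (free_product G H))"
proof -
  interpret F: group "free_product G H" by (rule group_free_product)
  interpret L: group_hom "free_product G H" M lift
    by (simp add: group_hom_def group_hom_axioms_def F.is_group M.is_group lift_hom)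
  have "U = \<one>\<^bsub>free_product G H\<^esub>"
    if U: "U \<in> carrier (free_product G H)" "lift U = \<one>\<^bsub>M\<^esub>" for U
  proof -
    obtain w where "w \<in> words G H" "U = word_class G H w"
      using U(1) by (auto simp: carrier_free_product)
    then show ?thesis
      using U(2) assms[of w] by (simp add: one_free_product lift_class class_eq_iff)
  qed
  then show ?thesis by (simp add: L.inj_on_one_iff)
qed

end


section \<open>Reduced words\<close>

definition reduced :: "('a, 'c) monoid_scheme \<Rightarrow> ('b, 'd) monoid_scheme \<Rightarrow> ('a + 'b) list \<Rightarrow> bool" where
  "reduced G H w \<longleftrightarrow>
     w \<in> words G H \<and> Inl \<one>\<^bsub>G\<^esub> \<notin> set w \<and> Inr \<one>\<^bsub>H\<^esub> \<notin> set w \<and> successively (\<lambda>x y. isl x \<noteq> isl y) w"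

lemma not_successively_split:
  "\<not> successively P w \<Longrightarrow> \<exists>u x y v. w = u @ [x, y] @ v \<and> \<not> P x y"
proof (induction P w rule: successively.induct)
  case (3 P x y xs)
  show ?case
  proof (cases "P x y")
    case True
    with 3 obtain u a b v where "y # xs = u @ [a, b] @ v" "\<not> P a b" by auto
    then show ?thesis by (intro exI[of _ "x # u"]) auto
  next
    case False
    then show ?thesis by (intro exI[of _ "[]"]) auto
  qed
qed auto

context group_pair
begin

text \<open>
  Each way of failing to be reduced is a chance to apply one of the generating rules of the
  congruence in the direction that shortens the word.
\<close>
lemma not_reduced_shorten:
  assumes w: "w \<in> words G H" and "\<not> reduced G H w"
  shows "\<exists>v. (w, v) \<in> word_cong G H \<and> length v < length w"
proof -
  consider (one1) "Inl \<one>\<^bsub>G\<^esub> \<in> set w" | (one2) "Inr \<one>\<^bsub>H\<^esub> \<in> set w"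
    | (adjacent) "\<not> successively (\<lambda>x y. isl x \<noteq> isl y) w"
    using assms by (auto simp: reduced_def)
  then show ?thesis
  proof cases
    case one1
    then obtain u v where uv: "w = u @ [Inl \<one>\<^bsub>G\<^esub>] @ v" by (auto dest: split_list)
    with w have "(w, u @ v) \<in> word_cong G H" using word_cong.one1[of u G H v] by simp
    then show ?thesis using uv by auto
  next
    case one2
    then obtain u v where uv: "w = u @ [Inr \<one>\<^bsub>H\<^esub>] @ v" by (auto dest: split_list)
    with w have "(w, u @ v) \<in> word_cong G H" using word_cong.one2[of u G H v] by simp
    then show ?thesis using uv by auto
  next
    case adjacent
    then obtain u x y v where uv: "w = u @ [x, y] @ v" and "isl x = isl y"
      using not_successively_split by blast
    then consider a b where "x = Inl a" "y = Inl b" | a b where "x = Inr a" "y = Inr b"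
      by (cases x; cases y) auto
    then show ?thesis
    proof cases
      case (1 a b)
      then have "(w, u @ [Inl (a \<otimes>\<^bsub>G\<^esub> b)] @ v) \<in> word_cong G H"
        using uv w word_cong.mult1[of u G H v a b] by simp
      then show ?thesis using uv by (intro exI conjI) auto
    next
      case (2 a b)
      then have "(w, u @ [Inr (a \<otimes>\<^bsub>H\<^esub> b)] @ v) \<in> word_cong G H"
        using uv w word_cong.mult2[of u G H v a b] by simp
      then show ?thesis using uv by (intro exI conjI) auto
    qed
  qed
qed

lemma reduced_form:
  assumes "w \<in> words G H"
  shows "\<exists>v. reduced G H v \<and> (w, v) \<in> word_cong G H"
  using assms
proof (induction w rule: length_induct)
  case (1 w)
  show ?case
  proof (cases "reduced G H w")
    case True
    then show ?thesis using 1 word_cong.refl by blast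
  next
    case False
    then obtain v where v: "(w, v) \<in> word_cong G H" "length v < length w"
      using not_reduced_shorten 1 by blast
    then show ?thesis using 1 cong_words word_cong.trans by meson
  qed
qed

end

text \<open>
  A word in the kernel is congruent to a reduced word, which is again in the kernel and therefore
  empty.
\<close>
lemma (in hom_pair) lift_mon:
  assumes "\<And>w. reduced G H w \<Longrightarrow> w \<noteq> [] \<Longrightarrow> word_prod M f g w \<noteq> \<one>\<^bsub>M\<^esub>"
  shows "lift \<in> mon (free_product G H) M"
proof -
  have "(w, []) \<in> word_cong G H" if "w \<in> words G H" "word_prod M f g w = \<one>\<^bsub>M\<^esub>" for w
  proof -
    obtain v where "reduced G H v" "(w, v) \<in> word_cong G H"
      using reduced_form \<open>w \<in> words G H\<close> by blast
    then show ?thesis using assms[of v] word_prod_cong that(2) by auto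
  qed
  then show ?thesis using lift_hom inj_on_lift by (simp add: mon_def)
qed


section \<open>A free product is the internal free product of its two factors\<close>

lemma map_sum_cong:
  assumes f: "f \<in> hom G G'" and g: "g \<in> hom H H'"
    and G: "group G" "group G'" and H: "group H" "group H'"
    and "(v, w) \<in> word_cong G H"
  shows "(map (map_sum f g) v, map (map_sum f g) w) \<in> word_cong G' H'"
proof -
  have w: "map (map_sum f g) u \<in> words G' H'" if "u \<in> words G H" for u
    using that f g by (induction u) (auto simp: words_def hom_in_carrier)
  have one: "f \<one>\<^bsub>G\<^esub> = \<one>\<^bsub>G'\<^esub>" "g \<one>\<^bsub>H\<^esub> = \<one>\<^bsub>H'\<^esub>"
    using f g G H by (simp_all add: hom_one)
  show ?thesis
    using assms(7)
  proof (induction rule: word_cong.induct)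
    case (refl w) then show ?case by (simp add: w word_cong.refl)
  next
    case (sym v w) then show ?case by (blast intro: word_cong.sym)
  next
    case (trans u v w) then show ?case by (blast intro: word_cong.trans)
  next
    case (one1 u v) then show ?case using word_cong.one1[of _ G' H'] w by (simp add: one)
  next
    case (one2 u v) then show ?case using word_cong.one2[of _ G' H'] w by (simp add: one)
  next
    case (mult1 u v x y)
    then show ?case using word_cong.mult1[of _ G' H' _ "f x" "f y"] w f
      by (simp add: hom_in_carrier hom_mult)
  next
    case (mult2 u v x y)
    then show ?case using word_cong.mult2[of _ G' H' _ "g x" "g y"] w g
      by (simp add: hom_in_carrier hom_mult)
  qed
qed

context group_pair
begin

text \<open>
  Let \<open>A\<close> and \<open>B\<close> be the images of the factors. Evaluation of words over \<open>A\<close> and \<open>B\<close> in the free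
  product is undone by replacing each letter of a representative over \<open>G\<close> and \<open>H\<close> by its class.
  This is why evaluation is surjective, and it is also injective because the replacement
  respects congruence (\<open>map_sum_cong\<close>).
\<close>
lemma is_free_product_of_free_product:
  "is_free_product_of (free_product G H)
     ((\<lambda>a. word_class G H [Inl a]) ` carrier G) ((\<lambda>b. word_class G H [Inr b]) ` carrier H)"
  (is "is_free_product_of ?F (?i ` _) (?j ` _)")
proof -
  interpret F: group ?F by (rule group_free_product)
  let ?A = "?i ` carrier G" and ?B = "?j ` carrier H"
  let ?FA = "?F\<lparr>carrier := ?A\<rparr>" and ?FB = "?F\<lparr>carrier := ?B\<rparr>"
  have A: "subgroup ?A ?F"
    using group_hom.img_is_subgroup[of G ?F ?i] inl_hom G.is_group F.is_group
    by (simp add: group_hom_def group_hom_axioms_def)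
  have B: "subgroup ?B ?F"
    using group_hom.img_is_subgroup[of H ?F ?j] inr_hom H.is_group F.is_group
    by (simp add: group_hom_def group_hom_axioms_def)
  have gA: "group ?FA" and gB: "group ?FB"
    using A B F.is_group by (simp_all add: subgroup.subgroup_is_group)
  have subA: "?A \<subseteq> carrier ?F" and subB: "?B \<subseteq> carrier ?F"
    using A B by (simp_all add: subgroup.subset)
  have carriers: "carrier ?FA = ?A" "carrier ?FB = ?B" by simp_all
  have iA: "?i \<in> hom G ?FA" and jB: "?j \<in> hom H ?FB"
    using inl_hom inr_hom by (auto simp: hom_def)
  interpret P: hom_pair ?FA ?FB ?F id id
    using gA gB F.is_group subA subB
    by (auto simp: hom_pair_def hom_pair_axioms_def group_pair_def hom_def)
  have eval: "word_prod ?F id id (map (map_sum ?i ?j) v) = word_class G H v"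
    if "v \<in> words G H" for v
    using that
  proof (induction v)
    case (Cons x v)
    then have xv: "[x] \<in> words G H" "v \<in> words G H" by (auto simp: words_def)
    have "case_sum id id (map_sum ?i ?j x) = word_class G H [x]" by (cases x) auto
    then show ?case
      using Cons.IH[OF xv(2)] mult_class[OF xv] by (simp only: list.map word_prod.simps append.simps)
  qed (simp add: one_free_product)
  have words: "\<exists>v\<in>words G H. w = map (map_sum ?i ?j) v" if "w \<in> words ?FA ?FB" for w
    using that
  proof (induction w)
    case Nil
    show ?case by (rule bexI[of _ "[]"]) auto
  next
    case (Cons x w)
    then obtain v where v: "v \<in> words G H" "w = map (map_sum ?i ?j) v"
      by (auto simp: words_def)
    have "x \<in> ?A <+> ?B" using Cons.prems by (auto simp: words_def)
    then consider a where "a \<in> carrier G" "x = Inl (?i a)" | b where "b \<in> carrier H" "x = Inr (?j b)"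
      by (elim PlusE imageE) simp_all
    then show ?case
    proof cases
      case (1 a)
      then show ?thesis using v by (intro bexI[of _ "Inl a # v"]) simp_all
    next
      case (2 b)
      then show ?thesis using v by (intro bexI[of _ "Inr b # v"]) simp_all
    qed
  qed
  have "inj_on P.lift (carrier (free_product ?FA ?FB))"
  proof (rule P.inj_on_lift)
    fix w assume "w \<in> words ?FA ?FB" and 1: "word_prod ?F id id w = \<one>\<^bsub>?F\<^esub>"
    then obtain v where v: "v \<in> words G H" "w = map (map_sum ?i ?j) v"
      using words by blast
    with 1 have "(v, []) \<in> word_cong G H"
      using eval by (simp add: one_free_product class_eq_iff)
    then show "(w, []) \<in> word_cong ?FA ?FB"
      using map_sum_cong[OF iA jB G.is_group gA H.is_group gB] v by fastforce
  qed
  moreover have "P.lift ` carrier (free_product ?FA ?FB) = carrier ?F"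
  proof
    show "P.lift ` carrier (free_product ?FA ?FB) \<subseteq> carrier ?F"
      using P.lift_hom by (auto simp: hom_in_carrier)
    show "carrier ?F \<subseteq> P.lift ` carrier (free_product ?FA ?FB)"
    proof
      fix U assume "U \<in> carrier ?F"
      then obtain v where v: "v \<in> words G H" "U = word_class G H v"
        by (auto simp: carrier_free_product)
      have m: "map (map_sum ?i ?j) v \<in> words ?FA ?FB"
        using map_sum_cong[OF iA jB G.is_group gA H.is_group gB word_cong.refl[OF v(1)]]
          P.cong_words by blast
      then show "U \<in> P.lift ` carrier (free_product ?FA ?FB)"
        unfolding P.carrier_free_product
        using P.lift_class[OF m] eval[OF v(1)] v(2) by (intro image_eqI[OF _ imageI[OF m]]) simp
    qed
  qed
  ultimately have "P.lift \<in> iso (free_product ?FA ?FB) ?F"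
    using P.lift_hom by (simp add: iso_iff)
  moreover have "P.lift (word_class ?FA ?FB [Inl a]) = a" if "a \<in> ?A" for a
  proof -
    have "a \<in> carrier ?F" using that subA by blast
    moreover have "[Inl a] \<in> words ?FA ?FB"
      using that by (simp only: words_Inl words_Nil carriers simp_thms)
    ultimately show ?thesis by (simp only: P.lift_class word_prod.simps sum.case id_apply F.r_one)
  qed
  moreover have "P.lift (word_class ?FA ?FB [Inr b]) = b" if "b \<in> ?B" for b
  proof -
    have "b \<in> carrier ?F" using that subB by blast
    moreover have "[Inr b] \<in> words ?FA ?FB"
      using that by (simp only: words_Inr words_Nil carriers simp_thms)
    ultimately show ?thesis by (simp only: P.lift_class word_prod.simps sum.case id_apply F.r_one)
  qed
  ultimately show ?thesis
    unfolding is_free_product_of_def using A B by blast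
qed

end

lemma FPV_free_product:
  assumes "hom_pair G H thompson_V f g"
    and faithful: "\<And>w. reduced G H w \<Longrightarrow> w \<noteq> [] \<Longrightarrow> word_prod thompson_V f g w \<noteq> \<one>\<^bsub>thompson_V\<^esub>"
    and "carrier G \<noteq> {\<one>\<^bsub>G\<^esub>}" and "carrier H \<noteq> {\<one>\<^bsub>H\<^esub>}"
  shows "FPV (free_product G H)"
proof -
  interpret hom_pair G H thompson_V f g by fact
  let ?F = "free_product G H"
  have lift_one: "lift \<one>\<^bsub>?F\<^esub> = \<one>\<^bsub>thompson_V\<^esub>"
    by (simp add: one_free_product lift_class)
  have "\<exists>a\<in>carrier G. a \<noteq> \<one>\<^bsub>G\<^esub>" "\<exists>b\<in>carrier H. b \<noteq> \<one>\<^bsub>H\<^esub>"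
    using assms(3,4) G.one_closed H.one_closed by blast+
  then obtain a b where a: "a \<in> carrier G" "a \<noteq> \<one>\<^bsub>G\<^esub>" and b: "b \<in> carrier H" "b \<noteq> \<one>\<^bsub>H\<^esub>"
    by blast
  have "lift (word_class G H [Inl a]) \<noteq> \<one>\<^bsub>thompson_V\<^esub>"
    using faithful[of "[Inl a]"] a by (simp add: lift_class reduced_def)
  moreover have "lift (word_class G H [Inr b]) \<noteq> \<one>\<^bsub>thompson_V\<^esub>"
    using faithful[of "[Inr b]"] b by (simp add: lift_class reduced_def)
  ultimately have "(\<lambda>a. word_class G H [Inl a]) ` carrier G \<noteq> {\<one>\<^bsub>?F\<^esub>}"
    and "(\<lambda>b. word_class G H [Inr b]) ` carrier H \<noteq> {\<one>\<^bsub>?F\<^esub>}"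
    using a(1) b(1) lift_one by (metis imageI singletonD)+
  moreover have "embeds_into_V ?F"
    using lift_mon faithful unfolding embeds_into_V_def by blast
  ultimately show ?thesis
    unfolding FPV_def using group_free_product is_free_product_of_free_product by blast
qed


section \<open>Finite prefixes of points of the Cantor set\<close>

definition cone :: "node \<Rightarrow> cantor set" where
  "cone n = range (conc n)"

lemma conc_split:
  fixes p :: "nat \<Rightarrow> 'a"
  obtains x w where "length x = k" and "p = x \<frown> w"
proof
  show "length (map p [0..<k]) = k" by simp
  show "p = map p [0..<k] \<frown> (\<lambda>i. p (i + k))" by (rule ext) (simp add: conc_def)
qed

lemma conc_eq_same_length:
  assumes "x \<frown> w = y \<frown> v" and "length x = length y"
  shows "x = y \<and> w = v"
proof
  show "x = y"
    using assms by (intro nth_equalityI) (metis conc_fst)+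
  show "w = v"
  proof
    fix i show "w i = v i"
      using fun_cong[OF assms(1), of "i + length x"] assms(2) by (simp add: conc_def)
  qed
qed

lemma conc_eq_extends:
  assumes "x \<frown> w = y \<frown> v" and "length x \<le> length y"
  shows "\<exists>r. y = x @ r \<and> w = r \<frown> v"
proof -
  obtain r u where r: "length r = length y - length x" "w = r \<frown> u"
    by (rule conc_split)
  have "(x @ r) \<frown> u = y \<frown> v" using assms(1) r(2) by simp
  then have "x @ r = y \<and> u = v" by (rule conc_eq_same_length) (simp add: assms(2) r(1))
  then show ?thesis using r(2) by blast
qed

lemma conc_eq_comparable:
  assumes "x \<frown> w = y \<frown> v"
  shows "Sublist.prefix x y \<or> Sublist.prefix y x"
  using conc_eq_extends[OF assms] conc_eq_extends[OF assms[symmetric]]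
  by (metis nat_le_linear prefixI)


section \<open>Elements of V as bijections replacing prefixes of a fixed length\<close>

text \<open>
  Every element of V has this property for all large \<open>N\<close>: the finite domain tree can be enlarged to
  the full binary tree of depth \<open>N\<close>. The replacements \<open>y\<close> may have any length.
\<close>
definition replaces_prefixes :: "nat \<Rightarrow> (cantor \<Rightarrow> cantor) \<Rightarrow> bool" where
  "replaces_prefixes N f \<longleftrightarrow> (\<forall>x. length x = N \<longrightarrow> (\<exists>y. \<forall>w. f (x \<frown> w) = y \<frown> w))"

text \<open>
  Digit \<open>i\<close> of the image either belongs to the replacement, which the first \<open>N\<close> digits determine, or
  is a digit of the point at position at most \<open>N + i\<close>. Hence it is constant on the cylinder of all
  points that agree with a given one in these positions.
\<close>
lemma replaces_prefixes_continuous: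
  assumes f: "replaces_prefixes N f"
  shows "continuous_on UNIV f"
proof (rule continuous_on_coordinatewise_then_product)
  fix i
  have "open ((\<lambda>p. f p i) -` B)" for B
  proof (subst open_subopen, intro ballI)
    fix p assume p: "p \<in> (\<lambda>p. f p i) -` B"
    let ?T = "{q. \<forall>j\<in>{..N + i}. q j \<in> {p j}}"
    have "open ?T"
      by (rule product_topology_basis'[where x = "\<lambda>i. i"]) (simp_all add: open_discrete)
    moreover have "q \<in> (\<lambda>p. f p i) -` B" if "q \<in> ?T" for q
    proof -
      obtain x w where x: "length x = N" "p = x \<frown> w" by (rule conc_split)
      obtain x' v where x': "length x' = N" "q = x' \<frown> v" by (rule conc_split)
      have agree: "(x' \<frown> v) j = (x \<frown> w) j" if "j \<le> N + i" for j
      proof -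
        have "q j = p j" using that \<open>q \<in> ?T\<close> by blast
        then show ?thesis by (simp only: x(2) x'(2))
      qed
      have "x' = x"
      proof (rule nth_equalityI)
        fix j assume "j < length x'"
        then show "x' ! j = x ! j" using agree[of j] x(1) x'(1) by simp
      qed (simp add: x(1) x'(1))
      have v: "v j = w j" if "j \<le> i" for j
        using agree[of "N + j"] that x(1) x'(1) by (simp add: conc_def)
      obtain y where y: "\<And>w. f (x \<frown> w) = y \<frown> w"
        using f x(1) by (auto simp: replaces_prefixes_def)
      have "(y \<frown> v) i = (y \<frown> w) i" using v by (simp add: conc_def)
      then have "f q i = f p i" unfolding x(2) x'(2) \<open>x' = x\<close> y .
      then show ?thesis using p by (simp only: vimage_eq)
    qed
    ultimately show "\<exists>T. open T \<and> p \<in> T \<and> T \<subseteq> (\<lambda>p. f p i) -` B"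
      by (intro exI[of _ ?T]) blast
  qed
  then show "continuous_on UNIV (\<lambda>p. f p i)"
    by (simp add: continuous_on_open_vimage)
qed

lemma replaces_prefixes_comp:
  assumes f: "replaces_prefixes N f" and g: "replaces_prefixes M g"
  shows "replaces_prefixes (N + M) (g \<circ> f)"
  unfolding replaces_prefixes_def
proof (intro allI impI)
  fix x :: node assume x: "length x = N + M"
  then obtain y where y: "\<And>w. f (take N x \<frown> w) = y \<frown> w"
    using f unfolding replaces_prefixes_def by (metis length_take min_absorb2 le_add1)
  let ?z = "y @ drop N x"
  have "length (take M ?z) = M" using x by simp
  then obtain y' where y': "\<And>w. g (take M ?z \<frown> w) = y' \<frown> w"
    using g unfolding replaces_prefixes_def by blast
  have "(g \<circ> f) (x \<frown> w) = (y' @ drop M ?z) \<frown> w" for w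
  proof -
    have "f (x \<frown> w) = ?z \<frown> w"
      using y[of "drop N x \<frown> w"] by simp
    also have "\<dots> = take M ?z \<frown> drop M ?z \<frown> w"
      by (simp only: conc_conc append_take_drop_id)
    finally have "(g \<circ> f) (x \<frown> w) = g (take M ?z \<frown> drop M ?z \<frown> w)"
      by (simp only: o_apply)
    also have "\<dots> = y' \<frown> drop M ?z \<frown> w" by (rule y')
    finally show ?thesis by (simp only: conc_conc)
  qed
  then show "\<exists>y. \<forall>w. (g \<circ> f) (x \<frown> w) = y \<frown> w" by blast
qed

lemma finite_nodes_of_length: "finite {x :: node. length x = N}"
  using finite_lists_length_eq[of "UNIV :: bool set" N] by simp

text \<open>
  If \<open>M\<close> bounds the lengths of all replacements, then each node of length \<open>M\<close> extends some replacement
  \<open>\<sigma> x\<close>, and the inverse replaces that part by \<open>x\<close>.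
\<close>
lemma replaces_prefixes_inv:
  assumes "bij f" and f: "replaces_prefixes N f"
  shows "\<exists>M. replaces_prefixes M (inv_into UNIV f)"
proof -
  obtain \<sigma> where \<sigma>: "\<And>x w. length x = N \<Longrightarrow> f (x \<frown> w) = \<sigma> x \<frown> w"
    using f unfolding replaces_prefixes_def by metis
  obtain M where M: "\<And>x. length x = N \<Longrightarrow> length (\<sigma> x) \<le> M"
    using finite_nodes_of_length[of N] finite_imageI[of "{x. length x = N}" "length \<circ> \<sigma>"]
    by (auto simp: finite_nat_set_iff_bounded_le)
  have "\<exists>y. \<forall>w. inv_into UNIV f (z \<frown> w) = y \<frown> w" if z: "length z = M" for z
  proof -
    obtain x v where x: "length x = N" "inv_into UNIV f (z \<frown> (\<lambda>_. False)) = x \<frown> v"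
      by (rule conc_split)
    then have "\<sigma> x \<frown> v = z \<frown> (\<lambda>_. False)"
      using \<sigma> \<open>bij f\<close> by (metis bij_inv_eq_iff)
    then obtain r where "z = \<sigma> x @ r"
      using conc_eq_extends M x z by metis
    then have "f ((x @ r) \<frown> w) = z \<frown> w" for w
      using \<sigma>[OF x(1), of "r \<frown> w"] by simp
    then have "\<forall>w. inv_into UNIV f (z \<frown> w) = (x @ r) \<frown> w"
      using \<open>bij f\<close> by (metis bij_inv_eq_iff)
    then show ?thesis by blast
  qed
  then show ?thesis unfolding replaces_prefixes_def by blast
qed

text \<open>
  A node longer than all nodes of \<open>D\<close> leaves \<open>D\<close> through a leaf. The leaf is found as the first
  initial segment whose continuation is outside \<open>D\<close>; the other child is outside as well because each
  node of \<open>D\<close> has none or two children.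
\<close>
lemma represents_imp_replaces_prefixes:
  assumes "represents D R \<sigma> f"
  shows "\<exists>N. replaces_prefixes N f"
proof -
  have D: "finite_subtree D" and f: "\<And>i w. i \<in> leaves D \<Longrightarrow> f (i \<frown> w) = \<sigma> i \<frown> w"
    using assms by (auto simp: represents_def tree_pair_def)
  obtain N where N: "\<And>x. x \<in> D \<Longrightarrow> length x < N"
    using D finite_imageI[of D length]
    by (auto simp: finite_subtree_def finite_nat_set_iff_bounded)
  have "\<exists>y. \<forall>w. f (x \<frown> w) = y \<frown> w" if x: "length x = N" for x
  proof -
    define k where "k = (LEAST k. take (Suc k) x \<notin> D)"
    have "take (Suc N) x \<notin> D" using N x by force
    then have k1: "take (Suc k) x \<notin> D" unfolding k_def by (rule LeastI)
    have "take k x \<in> D"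
    proof (cases k)
      case 0
      then show ?thesis using D by (simp add: finite_subtree_def)
    next
      case (Suc j)
      then have "j < (LEAST k. take (Suc k) x \<notin> D)" by (simp add: k_def)
      then show ?thesis using Suc not_less_Least by blast
    qed
    moreover have "k < length x" using k1 \<open>take k x \<in> D\<close> by (cases "k < length x") auto
    ultimately have xk: "take k x @ [x ! k] \<notin> D"
      using k1 by (simp add: take_Suc_conv_app_nth)
    have "take k x @ [b] \<notin> D" for b
    proof
      assume b: "take k x @ [b] \<in> D"
      then have "take k x @ [\<not> b] \<in> D" using D unfolding finite_subtree_def by blast
      then show False using b xk by (cases "b = x ! k") auto
    qed
    then have "take k x \<in> leaves D"
      using \<open>take k x \<in> D\<close> by (simp add: leaves_def)
    then have "f (x \<frown> w) = (\<sigma> (take k x) @ drop k x) \<frown> w" for w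
      using f[of "take k x" "drop k x \<frown> w"] by simp
    then show ?thesis by blast
  qed
  then show ?thesis unfolding replaces_prefixes_def by blast
qed

text \<open>
  Take the full tree of depth \<open>N\<close> as the domain. By injectivity the replacements form an antichain,
  and by surjectivity their cones cover the Cantor set. Together these make the set of all prefixes
  of the replacements a tree in which each node has none or two children, and whose leaves are exactly
  the replacements.
\<close>
lemma replaces_prefixes_imp_represents:
  assumes "bij f" and "replaces_prefixes N f"
  shows "\<exists>D R \<sigma>. represents D R \<sigma> f"
proof -
  obtain \<sigma> where \<sigma>: "\<And>x w. length x = N \<Longrightarrow> f (x \<frown> w) = \<sigma> x \<frown> w"
    using assms(2) unfolding replaces_prefixes_def by metis
  have antichain: "x = x'"
    if "length x = N" "length x' = N" and "Sublist.prefix (\<sigma> x) (\<sigma> x')" for x x'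
  proof -
    obtain r where "\<sigma> x' = \<sigma> x @ r" using \<open>Sublist.prefix (\<sigma> x) (\<sigma> x')\<close> by (auto simp: prefix_def)
    then have "f (x' \<frown> (\<lambda>_. False)) = f (x \<frown> r \<frown> (\<lambda>_. False))"
      using \<sigma>[OF \<open>length x = N\<close>, of "r \<frown> (\<lambda>_. False)"] \<sigma>[OF \<open>length x' = N\<close>, of "\<lambda>_. False"]
      by simp
    then have "x' \<frown> (\<lambda>_. False) = x \<frown> r \<frown> (\<lambda>_. False)"
      using \<open>bij f\<close> by (metis bij_is_inj injD)
    then show ?thesis using conc_eq_same_length that by metis
  qed
  define L where "L = {x :: node. length x = N}"
  define D where "D = {x :: node. length x \<le> N}"
  define R where "R = (\<Union>x\<in>L. {z. Sublist.prefix z (\<sigma> x)})"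
  have "finite D"
    using finite_lists_length_le[of "UNIV :: bool set" N] by (simp add: D_def)
  then have "finite_subtree D" by (auto simp: D_def finite_subtree_def)
  moreover have leaves_D: "leaves D = L" by (auto simp: D_def L_def leaves_def)
  moreover have "finite_subtree R"
  proof -
    have "finite {z. Sublist.prefix z (\<sigma> x)}" for x
      using finite_set[of "prefixes (\<sigma> x)"] by (simp add: set_prefixes_eq)
    then have "finite R"
      using finite_nodes_of_length by (simp add: R_def L_def)
    moreover have "replicate N False \<in> L" by (simp add: L_def)
    then have "[] \<in> R" by (auto simp: R_def)
    moreover have "z \<in> R" if "z @ [b] \<in> R" for z b
      using that by (auto simp: R_def dest: append_prefixD)
    moreover have "z @ [\<not> b] \<in> R" if zb: "z @ [b] \<in> R" for z b
    proof -
      obtain x where x: "x \<in> L" "Sublist.prefix (z @ [b]) (\<sigma> x)" using zb by (auto simp: R_def)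
      \<comment> \<open>Some replacement is comparable with the sibling. It cannot be a prefix of \<open>z\<close>, as it
        would then be a proper prefix of \<open>\<sigma> x\<close>.\<close>
      obtain x' v where x': "length x' = N" "inv_into UNIV f ((z @ [\<not> b]) \<frown> (\<lambda>_. False)) = x' \<frown> v"
        by (rule conc_split)
      then have "\<sigma> x' \<frown> v = (z @ [\<not> b]) \<frown> (\<lambda>_. False)"
        using \<sigma> \<open>bij f\<close> by (metis bij_inv_eq_iff)
      then consider "Sublist.prefix (z @ [\<not> b]) (\<sigma> x')" | "Sublist.prefix (\<sigma> x') z"
        using conc_eq_comparable by (metis prefix_order.refl prefix_snoc)
      then show ?thesis
      proof cases
        case 1
        then show ?thesis using x' by (auto simp: R_def L_def)
      next
        case 2
        then have "Sublist.prefix (\<sigma> x') (\<sigma> x)"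
          using x(2) append_prefixD prefix_order.trans by blast
        then have "x' = x" using antichain x x' by (auto simp: L_def)
        then show ?thesis using prefix_length_le[OF 2] prefix_length_le[OF x(2)] by simp
      qed
    qed
    ultimately show ?thesis by (auto simp: finite_subtree_def)
  qed
  moreover have "leaves R = \<sigma> ` L"
  proof
    show "leaves R \<subseteq> \<sigma> ` L"
    proof
      fix z assume z: "z \<in> leaves R"
      then obtain x where x: "x \<in> L" "Sublist.prefix z (\<sigma> x)" by (auto simp: leaves_def R_def)
      have "\<sigma> x = z"
      proof (rule ccontr)
        assume "\<sigma> x \<noteq> z"
        then obtain b r where "\<sigma> x = z @ b # r"
          using x(2) by (metis prefixE append_Nil2 neq_Nil_conv)
        then have "Sublist.prefix (z @ [b]) (\<sigma> x)" by (simp add: prefix_def)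
        then have "z @ [b] \<in> R" using x(1) by (auto simp: R_def)
        then show False using z by (simp add: leaves_def)
      qed
      then show "z \<in> \<sigma> ` L" using x by blast
    qed
    show "\<sigma> ` L \<subseteq> leaves R"
    proof
      fix z assume "z \<in> \<sigma> ` L"
      then obtain x where x: "x \<in> L" "z = \<sigma> x" by blast
      have "z @ [b] \<notin> R" for b
      proof
        assume "z @ [b] \<in> R"
        then obtain x' where x': "x' \<in> L" "Sublist.prefix (\<sigma> x @ [b]) (\<sigma> x')"
          using x by (auto simp: R_def)
        then have "x = x'" using antichain[of x x'] x append_prefixD by (auto simp: L_def)
        then show False using x'(2) prefix_length_le by fastforce
      qed
      then show "z \<in> leaves R" using x by (auto simp: leaves_def R_def)
    qed
  qed
  moreover have "inj_on \<sigma> L"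
    using antichain by (auto simp: inj_on_def L_def)
  ultimately have "represents D R \<sigma> f"
    using \<sigma> by (auto simp: represents_def tree_pair_def bij_betw_def L_def)
  then show ?thesis by blast
qed

lemma carrier_V: "carrier thompson_V = {f. bij f \<and> (\<exists>N. replaces_prefixes N f)}"
proof (intro equalityI subsetI)
  fix f assume "f \<in> carrier thompson_V"
  then obtain g D R \<sigma> where "homeomorphism UNIV UNIV f g" "represents D R \<sigma> f"
    by (auto simp: thompson_V_def)
  moreover from this(1) have "bij f"
    by (intro o_bij[of g f]) (auto simp: homeomorphism_def)
  ultimately show "f \<in> {f. bij f \<and> (\<exists>N. replaces_prefixes N f)}"
    using represents_imp_replaces_prefixes by blast
next
  fix f :: "cantor \<Rightarrow> cantor" assume "f \<in> {f. bij f \<and> (\<exists>N. replaces_prefixes N f)}"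
  then obtain N where f: "bij f" "replaces_prefixes N f" by blast
  then obtain M where "replaces_prefixes M (inv_into UNIV f)" using replaces_prefixes_inv by blast
  then have "homeomorphism UNIV UNIV f (inv_into UNIV f)"
    using f replaces_prefixes_continuous
    by (auto simp: homeomorphism_def bij_is_inj bij_is_surj bij_imp_bij_inv surj_f_inv_f)
  then show "f \<in> carrier thompson_V"
    using replaces_prefixes_imp_represents f by (auto simp: thompson_V_def)
qed

lemma mult_V [simp]: "f \<otimes>\<^bsub>thompson_V\<^esub> g = g \<circ> f"
  and one_V [simp]: "\<one>\<^bsub>thompson_V\<^esub> = id"
  by (simp_all add: thompson_V_def)

lemma comp_V: "f \<in> carrier thompson_V \<Longrightarrow> g \<in> carrier thompson_V \<Longrightarrow> g \<circ> f \<in> carrier thompson_V"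
  unfolding carrier_V using replaces_prefixes_comp bij_comp by blast

lemma inv_V: "f \<in> carrier thompson_V \<Longrightarrow> inv_into UNIV f \<in> carrier thompson_V"
  unfolding carrier_V using replaces_prefixes_inv bij_imp_bij_inv by blast

lemma group_V: "group thompson_V"
proof (rule groupI)
  show "\<one>\<^bsub>thompson_V\<^esub> \<in> carrier thompson_V"
    by (auto simp: carrier_V replaces_prefixes_def)
  fix f assume f: "f \<in> carrier thompson_V"
  then have "inv_into UNIV f \<otimes>\<^bsub>thompson_V\<^esub> f = \<one>\<^bsub>thompson_V\<^esub>"
    by (auto simp: carrier_V bij_is_surj surj_iff[THEN iffD1])
  then show "\<exists>g\<in>carrier thompson_V. g \<otimes>\<^bsub>thompson_V\<^esub> f = \<one>\<^bsub>thompson_V\<^esub>"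
    using inv_V f by blast
qed (auto simp: comp_V comp_assoc)


section \<open>Elements of V that expand a cone\<close>

text \<open>
  The element of V with domain leaves \<open>bc\<close>, \<open>b\<close> followed by the negation of \<open>c\<close>, and the negation of
  \<open>b\<close>, sent in this order to the negation of \<open>a\<close>, to \<open>a0\<close> and to \<open>a1\<close>. It brings the node \<open>bc\<close> one
  step closer to the root, while the cone of the negation of \<open>b\<close> shrinks into that of \<open>a1\<close>.
\<close>
definition zoom :: "bool \<Rightarrow> bool \<Rightarrow> bool \<Rightarrow> cantor \<Rightarrow> cantor" where
  "zoom a b c p =
    (if p 0 \<noteq> b then [a, True] \<frown> (\<lambda>i. p (i + 1))
     else if p 1 \<noteq> c then [a, False] \<frown> (\<lambda>i. p (i + 2))
     else [\<not> a] \<frown> (\<lambda>i. p (i + 2)))"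

definition unzoom :: "bool \<Rightarrow> bool \<Rightarrow> bool \<Rightarrow> cantor \<Rightarrow> cantor" where
  "unzoom a b c q =
    (if q 0 \<noteq> a then [b, c] \<frown> (\<lambda>i. q (i + 1))
     else if q 1 then [\<not> b] \<frown> (\<lambda>i. q (i + 2))
     else [b, \<not> c] \<frown> (\<lambda>i. q (i + 2)))"

lemma zoom_simps:
  "zoom a b c ([\<not> b] \<frown> w) = [a, True] \<frown> w"
  "zoom a b c ([b, \<not> c] \<frown> w) = [a, False] \<frown> w"
  "zoom a b c ([b, c] \<frown> w) = [\<not> a] \<frown> w"
  by (auto simp: zoom_def conc_def)

lemma unzoom_simps:
  "unzoom a b c ([a, True] \<frown> w) = [\<not> b] \<frown> w"
  "unzoom a b c ([a, False] \<frown> w) = [b, \<not> c] \<frown> w"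
  "unzoom a b c ([\<not> a] \<frown> w) = [b, c] \<frown> w"
  by (auto simp: unzoom_def conc_def)

lemma two_digit_prefix_cases:
  fixes p :: cantor
  obtains w where "p = [\<not> b] \<frown> w" | w where "p = [b, \<not> c] \<frown> w" | w where "p = [b, c] \<frown> w"
proof -
  obtain x w where x: "length x = 2" "p = x \<frown> w" by (rule conc_split)
  then obtain d e where "x = [d, e]" by (auto simp: numeral_2_eq_2 length_Suc_conv)
  then show thesis
    using that x conc_conc[of "[d]" "[e]" w] by (cases "d = b"; cases "e = c") auto
qed

lemma zoom_in_V: "zoom a b c \<in> carrier thompson_V"
proof -
  have "unzoom a b c (zoom a b c p) = p" for p
    by (rule two_digit_prefix_cases[where p = p and b = b and c = c]) (simp_all only: zoom_simps unzoom_simps)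
  moreover have "zoom a b c (unzoom a b c p) = p" for p
    by (rule two_digit_prefix_cases[where p = p and b = a and c = True])
      (simp_all only: zoom_simps unzoom_simps not_True_eq_False)
  ultimately have "bij (zoom a b c)" by (intro o_bij[of "unzoom a b c"]) auto
  moreover have "replaces_prefixes 2 (zoom a b c)"
    unfolding replaces_prefixes_def
  proof (intro allI impI)
    fix x :: node assume "length x = 2"
    then obtain d e where x: "x = [d, e]" by (auto simp: numeral_2_eq_2 length_Suc_conv)
    consider "d = (\<not> b)" | "d = b" "e = (\<not> c)" | "d = b" "e = c" by blast
    then show "\<exists>y. \<forall>w. zoom a b c (x \<frown> w) = y \<frown> w"
    proof cases
      case 1
      then have "zoom a b c (x \<frown> w) = [a, True, e] \<frown> w" for w
        using zoom_simps(1)[of a b c "[e] \<frown> w"] x by simp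
      then show ?thesis by blast
    qed (use x zoom_simps in blast)+
  qed
  ultimately show ?thesis by (auto simp: carrier_V)
qed

text \<open>
  Applying \<open>zoom\<close> repeatedly shortens the node until a single digit \<open>b\<close> is left; one last
  application then squeezes the complement, which is the cone of the negation of \<open>b\<close>, into the cone
  of \<open>a1\<close>. The target has depth two, so that the targets for the two values of \<open>a\<close> do not cover
  the Cantor set.
\<close>
lemma expand_cone:
  assumes "n \<noteq> []"
  shows "\<exists>c\<in>carrier thompson_V. - (c ` cone n) \<subseteq> cone [a, True]"
  using assms
proof (induction "length n" arbitrary: n rule: less_induct)
  case less
  consider b where "n = [b]" | b b' u where "n = b # b' # u"
    using less.prems by (metis neq_Nil_conv)
  then show ?case
  proof cases
    case (1 b)
    have "q \<in> cone [a, True]" if q: "q \<notin> zoom a b True ` cone n" for q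
    proof -
      have "bij (zoom a b True)" using zoom_in_V by (auto simp: carrier_V)
      then obtain p where p: "q = zoom a b True p" by (metis bij_pointE)
      show ?thesis
      proof (cases rule: two_digit_prefix_cases[where p = p and b = b and c = b])
        case (1 w)
        then show ?thesis using p zoom_simps(1) by (simp add: cone_def)
      next
        case (2 w)
        then have "p = [b] \<frown> [\<not> b] \<frown> w" by simp
        then show ?thesis using q p \<open>n = [b]\<close> unfolding cone_def by blast
      next
        case (3 w)
        then have "p = [b] \<frown> [b] \<frown> w" by simp
        then show ?thesis using q p \<open>n = [b]\<close> unfolding cone_def by blast
      qed
    qed
    then show ?thesis using zoom_in_V by blast
  next
    case (2 b b' u)
    obtain c where c: "c \<in> carrier thompson_V" "- (c ` cone ((\<not> a) # u)) \<subseteq> cone [a, True]"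
      using less.hyps[of "(\<not> a) # u"] 2 by auto
    have "zoom a b b' (n \<frown> w) = ((\<not> a) # u) \<frown> w" for w
      using zoom_simps(3)[of a b b' "u \<frown> w"] 2 by simp
    then have "(c \<circ> zoom a b b') ` cone n = c ` cone ((\<not> a) # u)"
      by (simp add: cone_def image_image flip: image_comp)
    then show ?thesis using c comp_V[OF zoom_in_V c(1)] by metis
  qed
qed


section \<open>Demonstration nodes and ping-pong\<close>

lemma leaves_incomparable:
  assumes "finite_subtree T" and m: "m \<in> leaves T" and n: "n \<in> leaves T" and "Sublist.prefix m n"
  shows "m = n"
proof (rule ccontr)
  assume "m \<noteq> n"
  then obtain b r where r: "n = m @ b # r"
    using \<open>Sublist.prefix m n\<close> by (metis prefixE append_Nil2 neq_Nil_conv)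
  have "(m @ [b]) @ s \<in> T \<Longrightarrow> m @ [b] \<in> T" for s
  proof (induction s rule: rev_induct)
    case (snoc x s)
    then show ?case using assms(1) by (metis append_assoc finite_subtree_def)
  qed simp
  then have "m @ [b] \<in> T" using n r by (auto simp: leaves_def)
  then show False using m by (simp add: leaves_def)
qed

text \<open>
  Neutrality of \<open>n\<close> is what makes \<open>n\<close> a leaf of the range tree; its image \<open>\<sigma> n\<close> is another leaf of
  that tree, and distinct leaves have disjoint cones.
\<close>
lemma demonstration_node_moves_cone:
  assumes "demonstration_node n K" and "g \<in> K" and "g \<noteq> id"
  shows "g ` cone n \<inter> cone n = {}"
proof -
  obtain D R \<sigma> where D: "represents D R \<sigma> g" "n \<in> neutral_leaves D R" "\<sigma> n \<noteq> n"
    using assms by (auto simp: demonstration_node_def)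
  then have R: "finite_subtree R" "n \<in> leaves R" "\<sigma> n \<in> leaves R"
    by (auto simp: represents_def tree_pair_def neutral_leaves_def bij_betw_def)
  have "g (n \<frown> w) \<noteq> n \<frown> v" for w v
  proof
    assume "g (n \<frown> w) = n \<frown> v"
    then have "\<sigma> n \<frown> w = n \<frown> v"
      using D by (auto simp: represents_def neutral_leaves_def)
    then show False
      using conc_eq_comparable leaves_incomparable R D(3) by metis
  qed
  then show ?thesis by (auto simp: cone_def)
qed

lemma demonstrative_conjugate:
  assumes "demonstrative K" and "K \<noteq> {\<one>\<^bsub>thompson_V\<^esub>}"
  shows "\<exists>f U. f \<in> hom (thompson_V\<lparr>carrier := K\<rparr>) thompson_V \<and> - U \<subseteq> cone [a, True] \<and>
    (\<forall>g\<in>K. g \<noteq> id \<longrightarrow> f g ` U \<inter> U = {})"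
proof -
  have K: "subgroup K thompson_V" using assms by (simp add: demonstrative_def)
  obtain n where n: "demonstration_node n K" using assms by (auto simp: demonstrative_def)
  obtain g where g: "g \<in> K" "g \<noteq> id"
    using assms(2) subgroup.one_closed[OF K] by auto
  \<comment> \<open>no map moves the whole Cantor set, the cone of the root, off itself\<close>
  have "n \<noteq> []"
    using demonstration_node_moves_cone[OF n g] by (auto simp: cone_def)
  then obtain c where c: "c \<in> carrier thompson_V" "- (c ` cone n) \<subseteq> cone [a, True]"
    using expand_cone by blast
  then have bij: "bij c" by (simp add: carrier_V)
  define f where "f g = c \<circ> g \<circ> inv_into UNIV c" for g
  have KV: "g \<in> carrier thompson_V" if "g \<in> K" for g
    using that subgroup.subset[OF K] by blast
  have "f \<in> hom (thompson_V\<lparr>carrier := K\<rparr>) thompson_V"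
  proof (rule homI)
    fix g assume "g \<in> carrier (thompson_V\<lparr>carrier := K\<rparr>)"
    then show "f g \<in> carrier thompson_V"
      unfolding f_def using KV comp_V inv_V c(1) by simp
  next
    fix g h
    show "f (g \<otimes>\<^bsub>thompson_V\<lparr>carrier := K\<rparr>\<^esub> h) = f g \<otimes>\<^bsub>thompson_V\<^esub> f h"
      using bij by (auto simp: f_def fun_eq_iff bij_is_inj)
  qed
  moreover have "f g ` c ` cone n \<inter> c ` cone n = {}" if "g \<in> K" "g \<noteq> id" for g
  proof -
    have "f g ` c ` cone n = c ` g ` cone n"
      using bij by (simp add: f_def image_image bij_is_inj)
    then show ?thesis
      using demonstration_node_moves_cone[OF n that] bij by (metis bij_is_inj image_Int image_empty)
  qed
  ultimately show ?thesis using c(2) by blast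
qed

text \<open>
  Because V acts on the right, letters act in the order in which they appear, and induction from the
  end of the word follows the orbit of \<open>p\<close>. The invariant is that the current point lies outside the
  set that belongs to the last letter; then it lies in the other set, to which the next letter, from
  the other factor, applies.
\<close>
lemma ping_pong:
  assumes "hom_pair G H thompson_V f g"
    and cover: "U \<union> W = UNIV" and p: "p \<in> U" "p \<in> W"
    and moves_U: "\<And>x. x \<in> carrier G \<Longrightarrow> x \<noteq> \<one>\<^bsub>G\<^esub> \<Longrightarrow> f x ` U \<inter> U = {}"
    and moves_W: "\<And>y. y \<in> carrier H \<Longrightarrow> y \<noteq> \<one>\<^bsub>H\<^esub> \<Longrightarrow> g y ` W \<inter> W = {}"
    and "reduced G H w" and "w \<noteq> []"
  shows "word_prod thompson_V f g w \<noteq> \<one>\<^bsub>thompson_V\<^esub>"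
proof -
  interpret hom_pair G H thompson_V f g by fact
  have "word_prod thompson_V f g w p \<notin> (if isl (last w) then U else W)"
    using assms(7,8)
  proof (induction w rule: rev_induct)
    case (snoc x w)
    have x: "[x] \<in> words G H" "w \<in> words G H" and w: "reduced G H w"
      using snoc.prems by (auto simp: reduced_def successively_append_iff)
    let ?q = "word_prod thompson_V f g w p"
    have eq: "word_prod thompson_V f g (w @ [x]) p = case_sum f g x ?q"
      using x by (simp add: word_prod_append)
    have q: "?q \<in> (if isl x then U else W)"
    proof (cases "w = []")
      case True
      then show ?thesis using p by simp
    next
      case False
      then have "isl (last w) \<noteq> isl x"
        using snoc.prems by (simp add: reduced_def successively_append_iff)
      then show ?thesis using snoc.IH[OF w False] cover by (auto split: if_splits)
    qed
    show ?case
    proof (cases x)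
      case (Inl a)
      then have "a \<in> carrier G" "a \<noteq> \<one>\<^bsub>G\<^esub>" using snoc.prems x by (auto simp: reduced_def)
      then show ?thesis using moves_U[of a] q eq Inl by auto
    next
      case (Inr b)
      then have "b \<in> carrier H" "b \<noteq> \<one>\<^bsub>H\<^esub>" using snoc.prems x by (auto simp: reduced_def)
      then show ?thesis using moves_W[of b] q eq Inr by auto
    qed
  qed simp
  then show ?thesis using p by (auto split: if_splits)
qed

theorem lemma1p3:
  fixes K1 K2 :: "(cantor \<Rightarrow> cantor) set"
  assumes "demonstrative K1" and "K1 \<noteq> {\<one>\<^bsub>thompson_V\<^esub>}"
    and "demonstrative K2" and "K2 \<noteq> {\<one>\<^bsub>thompson_V\<^esub>}"
  shows "FPV (free_product (thompson_V\<lparr>carrier := K1\<rparr>) (thompson_V\<lparr>carrier := K2\<rparr>)) \<and>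
         embeds_into_V (free_product (thompson_V\<lparr>carrier := K1\<rparr>) (thompson_V\<lparr>carrier := K2\<rparr>))"
proof -
  let ?G = "thompson_V\<lparr>carrier := K1\<rparr>" and ?H = "thompson_V\<lparr>carrier := K2\<rparr>"
  obtain f U where f: "f \<in> hom ?G thompson_V" "- U \<subseteq> cone [True, True]"
    "\<And>g. g \<in> K1 \<Longrightarrow> g \<noteq> id \<Longrightarrow> f g ` U \<inter> U = {}"
    using demonstrative_conjugate[OF assms(1,2)] by metis
  obtain h W where h: "h \<in> hom ?H thompson_V" "- W \<subseteq> cone [False, True]"
    "\<And>g. g \<in> K2 \<Longrightarrow> g \<noteq> id \<Longrightarrow> h g ` W \<inter> W = {}"
    using demonstrative_conjugate[OF assms(3,4)] by metis
  have "subgroup K1 thompson_V" "subgroup K2 thompson_V"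
    using assms by (simp_all add: demonstrative_def)
  then have "hom_pair ?G ?H thompson_V f h"
    using f(1) h(1) group_V
    by (simp add: hom_pair_def hom_pair_axioms_def group_pair_def subgroup.subgroup_is_group)
  \<comment> \<open>The complements of \<open>U\<close> and \<open>W\<close> are separated by digit 0; the zero sequence, whose digit 1 is
    \<open>False\<close>, is in neither.\<close>
  moreover have cone: "q \<in> cone [a, True] \<Longrightarrow> q 0 = a \<and> q 1" for q a
    by (auto simp: cone_def)
  have "U \<union> W = UNIV" using f(2) h(2) cone by blast
  moreover have "(\<lambda>_. False) \<in> U" "(\<lambda>_. False) \<in> W" using f(2) h(2) cone by blast+
  ultimately have "word_prod thompson_V f h w \<noteq> \<one>\<^bsub>thompson_V\<^esub>"
    if "reduced ?G ?H w" "w \<noteq> []" for w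
    using ping_pong[of ?G ?H f h U W "\<lambda>_. False" w] f(3) h(3) that by simp
  then have "FPV (free_product ?G ?H)"
    using \<open>hom_pair ?G ?H thompson_V f h\<close> assms by (intro FPV_free_product) simp_all
  then show ?thesis by (simp add: FPV_def)
qed

end
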